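(* Let $d\ge 1$, $T>0$, let $f:[0,T]\times\Sigma(\mathbb{R}^d)\to\hat\Sigma(\mathbb{R}^d)$ be a continuous function (with respect to the maximum norm), let $A_0\in\mathcal{K}_c(\mathbb{R}^d)$, let $r>0$, and put $D_r:=\{\sigma\in\Sigma(\mathbb{R}^d):\|\sigma-\sigma_{A_0}\|_\infty\le r\}$. Then there exists $c>0$ such that $$\|f(t,\sigma)\|_\infty\le c\quad\text{for all } t\in[0,T],\ \sigma\in D_r.$$ Let $b:=\min\{T,r/c\}$ for such a $c$. If, in addition, the subtangent condition $$f(t,\sigma)\in\overline{\Sigma(\mathbb{R}^d)-\mathbb{R}_0^+\sigma}\quad\text{for all } t\in[0,T],\ \sigma\in\Sigma(\mathbb{R}^d)$$ holds, then there exists a solution $\sigma:[0,b]\to D_r$ of the initial value problem $$\tfrac{d}{dt}\sigma(t)=f(t,\sigma(t)),\quad \sigma(0)=\sigma_{A_0}.$$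
   Context: $\mathcal{K}_c(\mathbb{R}^d)$ is the family of nonempty convex compact subsets of $\mathbb{R}^d$. $\mathbb{S}^{d-1}\subset\mathbb{R}^d$ is the Euclidean unit sphere and $C(\mathbb{S}^{d-1})$ is the Banach space of continuous real-valued functions on it with the maximum norm $\|\cdot\|_\infty$. For $A\in\mathcal{K}_c(\mathbb{R}^d)$ the support function is $\sigma_A:\mathbb{S}^{d-1}\to\mathbb{R}$, $\sigma_A(p)=\sup_{a\in A}\langle p,a\rangle$; it belongs to $C(\mathbb{S}^{d-1})$. Set $\Sigma(\mathbb{R}^d):=\{\sigma_A:A\in\mathcal{K}_c(\mathbb{R}^d)\}$ and $\hat\Sigma(\mathbb{R}^d):=\{\sigma_A-\sigma_B:A,B\in\mathcal{K}_c(\mathbb{R}^d)\}$, both regarded as subsets of $C(\mathbb{S}^{d-1})$. $\mathbb{R}_0^+=[0,\infty)$, and $\Sigma(\mathbb{R}^d)-\mathbb{R}_0^+\sigma=\{\tau-\lambda\sigma:\tau\in\Sigma(\mathbb{R}^d),\ \lambda\ge0\}$; the closure is taken in $C(\mathbb{S}^{d-1})$. A solution on $[0,b]$ is a continuous curve $\sigma:[0,b]\to C(\mathbb{S}^{d-1})$ with values in $\Sigma(\mathbb{R}^d)$ that satisfies the initial condition and is Fréchet differentiable (with respect to $\|\cdot\|_\infty$) with the differential equation holding at every $t\in(0,b)$. *)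

theory Defs
  imports "HOL-Analysis.Analysis"
begin

text \<open>The unit sphere of \<open>\<real>\<^sup>d\<close>, \<open>d = CARD('n) \<ge> 1\<close>, as a metric space with the distance inherited
  from \<open>\<real>\<^sup>d\<close>. It is a type of its own so that \<open>'n usphere \<Rightarrow>\<^sub>C real\<close> is the Banach space of
  continuous functions on the sphere with the maximum norm.\<close>

typedef ('n::finite) usphere = "sphere (0 :: real ^ 'n) 1"
  morphisms vec_of_usphere usphere_of_vec
proof -
  obtain b :: "real ^ 'n" where "b \<in> Basis" using nonempty_Basis by blast
  then show ?thesis by (intro exI[of _ b]) simp
qed

instantiation usphere :: (finite) metric_space
begin

definition dist_usphere :: "'a usphere \<Rightarrow> 'a usphere \<Rightarrow> real"
  where "dist_usphere p q = dist (vec_of_usphere p) (vec_of_usphere q)"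

definition uniformity_usphere :: "('a usphere \<times> 'a usphere) filter"
  where "uniformity_usphere = (INF e\<in>{0<..}. principal {(p, q). dist p q < e})"

definition open_usphere :: "'a usphere set \<Rightarrow> bool"
  where "open_usphere U \<longleftrightarrow> (\<forall>p\<in>U. \<forall>\<^sub>F (p', q) in uniformity. p' = p \<longrightarrow> q \<in> U)"

instance
proof
  fix p q s :: "'a usphere"
  show "(dist p q = 0) = (p = q)"
    by (simp add: dist_usphere_def vec_of_usphere_inject)
  show "dist p q \<le> dist p s + dist q s"
    by (simp add: dist_usphere_def dist_triangle2)
qed (fact uniformity_usphere_def open_usphere_def)+

end

lemma continuous_vec_of_usphere: "continuous_on A vec_of_usphere"
  unfolding continuous_on_iff dist_usphere_def by blast

lemma norm_vec_of_usphere [simp]: "norm (vec_of_usphere p) = 1"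
  using vec_of_usphere[of p] by simp

lemma compact_UNIV_usphere: "compact (UNIV :: ('n::finite) usphere set)"
proof -
  have "continuous_on (sphere (0 :: real ^ 'n) 1) usphere_of_vec"
    unfolding continuous_on_iff dist_usphere_def
    by (auto simp: usphere_of_vec_inverse)
  then have "compact (usphere_of_vec ` sphere (0 :: real ^ 'n) 1)"
    by (rule compact_continuous_image) (rule compact_sphere)
  moreover have "usphere_of_vec ` sphere (0 :: real ^ 'n) 1 = UNIV"
    using vec_of_usphere vec_of_usphere_inverse by (metis UNIV_eq_I image_eqI)
  ultimately show ?thesis by simp
qed

lemma bcontfun_usphere_iff:
  fixes g :: "('n::finite) usphere \<Rightarrow> real"
  shows "g \<in> bcontfun \<longleftrightarrow> continuous_on UNIV g"
  using compact_continuous_image[OF _ compact_UNIV_usphere, of g]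
  by (auto simp: bcontfun_def intro: compact_imp_bounded)

definition convex_bodies :: "(real ^ 'n) set set"
  where "convex_bodies = {A. A \<noteq> {} \<and> convex A \<and> compact A}"

definition support_function :: "(real ^ 'n) set \<Rightarrow> 'n usphere \<Rightarrow>\<^sub>C real"
  where "support_function A = Bcontfun (\<lambda>p. SUP a\<in>A. vec_of_usphere p \<bullet> a)"

text \<open>\<open>Bcontfun\<close> is meaningful only for bounded continuous arguments; this is the case here.\<close>

lemma apply_support_function:
  assumes "A \<in> convex_bodies"
  shows "apply_bcontfun (support_function A) p = (SUP a\<in>A. vec_of_usphere p \<bullet> a)"
proof -
  have ne: "A \<noteq> {}" and "compact A"
    using assms by (auto simp: convex_bodies_def)
  then obtain B where B: "B > 0" "\<And>a. a \<in> A \<Longrightarrow> norm a \<le> B"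
    using bounded_pos compact_imp_bounded by metis
  define h where "h = (\<lambda>p. SUP a\<in>A. vec_of_usphere p \<bullet> a)"
  have bdd: "bdd_above ((\<lambda>a. vec_of_usphere p \<bullet> a) ` A)" for p
  proof (rule bdd_aboveI2)
    fix a assume "a \<in> A"
    then show "vec_of_usphere p \<bullet> a \<le> B"
      using norm_cauchy_schwarz[of "vec_of_usphere p" a] B(2)[of a] by simp
  qed
  have le: "h p \<le> h q + B * dist p q" for p q
    unfolding h_def
  proof (rule cSUP_least[OF ne])
    fix a assume a: "a \<in> A"
    have "(vec_of_usphere p - vec_of_usphere q) \<bullet> a \<le> dist p q * norm a"
      using norm_cauchy_schwarz by (simp add: dist_usphere_def dist_norm)
    also have "\<dots> \<le> dist p q * B"
      using B(2)[OF a] by (intro mult_left_mono) auto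
    finally have "vec_of_usphere p \<bullet> a \<le> vec_of_usphere q \<bullet> a + B * dist p q"
      by (simp add: inner_diff_left mult.commute)
    also have "vec_of_usphere q \<bullet> a \<le> (SUP a\<in>A. vec_of_usphere q \<bullet> a)"
      using cSUP_upper[OF a bdd] .
    finally show "vec_of_usphere p \<bullet> a \<le> (SUP a\<in>A. vec_of_usphere q \<bullet> a) + B * dist p q"
      by simp
  qed
  have "B-lipschitz_on UNIV h"
  proof (rule lipschitz_onI)
    fix p q
    show "dist (h p) (h q) \<le> B * dist p q"
      using le[of p q] le[of q p] by (simp add: dist_real_def dist_commute abs_le_iff)
  qed (use B in simp)
  then have "continuous_on UNIV h"
    by (rule lipschitz_on_continuous_on)
  then have "h \<in> bcontfun"
    by (simp add: bcontfun_usphere_iff)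
  then show ?thesis
    by (simp add: support_function_def Bcontfun_inverse flip: h_def) (simp add: h_def)
qed

definition support_functions :: "('n::finite usphere \<Rightarrow>\<^sub>C real) set"
  where "support_functions = {support_function A | A. A \<in> convex_bodies}"

definition support_differences :: "('n::finite usphere \<Rightarrow>\<^sub>C real) set"
  where "support_differences =
    {support_function A - support_function B | A B. A \<in> convex_bodies \<and> B \<in> convex_bodies}"

definition support_ball :: "(real ^ 'n) set \<Rightarrow> real \<Rightarrow> ('n usphere \<Rightarrow>\<^sub>C real) set"
  where "support_ball A r = {\<sigma> \<in> support_functions. norm (\<sigma> - support_function A) \<le> r}"

definition subtangent_cone :: "('n::finite usphere \<Rightarrow>\<^sub>C real) \<Rightarrow> ('n usphere \<Rightarrow>\<^sub>C real) set"
  where "subtangent_cone \<sigma> = closure {\<tau> - l *\<^sub>R \<sigma> | \<tau> l. \<tau> \<in> support_functions \<and> l \<ge> 0}"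

definition ivp_solution ::
  "(real \<Rightarrow> ('n::finite usphere \<Rightarrow>\<^sub>C real) \<Rightarrow> ('n usphere \<Rightarrow>\<^sub>C real)) \<Rightarrow> ('n usphere \<Rightarrow>\<^sub>C real) \<Rightarrow> real
    \<Rightarrow> (real \<Rightarrow> ('n usphere \<Rightarrow>\<^sub>C real)) \<Rightarrow> bool"
  where "ivp_solution f \<sigma>\<^sub>0 b \<sigma> \<longleftrightarrow>
    continuous_on {0..b} \<sigma> \<and>
    (\<forall>t\<in>{0..b}. \<sigma> t \<in> support_functions) \<and>
    \<sigma> 0 = \<sigma>\<^sub>0 \<and>
    (\<forall>t\<in>{0<..<b}. (\<sigma> has_vector_derivative f t (\<sigma> t)) (at t))"

end

theory Submission
  imports Defs "HOL-Complex_Analysis.Great_Picard"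
begin

text \<open>The support functions form a closed convex cone \<open>K\<close> in the space of continuous functions on the
  sphere, and its intersections with closed balls are compact (Blaschke's selection theorem); hence
  the continuous right-hand side is bounded on the given ball. The existence part is then an instance of
  the Peano--Nagumo theorem for a convex set \<open>K\<close> with compact \<open>K \<inter> cball x\<^sub>0 r\<close>, proved here in an
  arbitrary normed space (theorem \<open>solution_exists\<close>).

  The point of the existence proof is that Euler's explicit scheme can be kept inside \<open>K\<close>. The
  tangency condition says that \<open>f t x\<close> is approximated by vectors \<open>s *\<^sub>R (y - x)\<close> with \<open>y \<in> K\<close>, and
  convexity keeps \<open>x + (h * s) *\<^sub>R (y - x)\<close> in \<open>K\<close> as long as \<open>h * s \<le> 1\<close>. By continuity a pair
  \<open>(s, y)\<close> that serves one point serves, up to a small error, all points near it, so by compactness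
  finitely many pairs suffice, and a single step size is admissible everywhere
  (lemma \<open>uniform_feasible_direction\<close>). Shrinking the directions slightly makes them no longer than
  the bound \<open>c\<close> of the field, so that the scheme does not leave the ball before time \<open>r / c\<close>.

  Euler's step functions are Lipschitz up to an error of the order of the step size. A diagonal
  argument over a countable dense set of times therefore gives a subsequence that converges at every time
  (lemma \<open>pointwise_convergent_subsequence\<close>). The estimate of an increment \<open>x t - x s\<close> by
  \<open>(t - s) *\<^sub>R w\<close>, valid when the field stays near \<open>w\<close> along the step function, survives the limit
  and is exactly differentiability of the limit.

  For support functions everything rests on one description: \<open>g\<close> is a support function iff in each
  direction \<open>p\<close> some point \<open>a\<close> attains \<open>g p\<close> while satisfying all the constraints
  \<open>q \<bullet> a \<le> g q\<close>. Sums, multiples and limits of support functions are treated by taking sums,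
  multiples and limits of such points.\<close>

section \<open>Selection of pointwise convergent subsequences\<close>

text \<open>The oscillation \<open>e n\<close> on top of the Lipschitz bound accommodates step functions whose steps
  shrink as \<open>n\<close> grows. Convergence on a countable dense set,
  obtained by diagonalization, spreads to all points because nearby values differ by a multiple of the
  distance plus an error that vanishes in the limit.\<close>
lemma pointwise_convergent_subsequence:
  fixes F :: "nat \<Rightarrow> 'a::{metric_space, second_countable_topology} \<Rightarrow> 'b::metric_space"
  assumes D: "compact D" and FD: "\<And>n x. x \<in> S \<Longrightarrow> F n x \<in> D"
    and lip: "\<And>n x y. x \<in> S \<Longrightarrow> y \<in> S \<Longrightarrow> dist (F n x) (F n y) \<le> L * dist x y + e n"
    and e: "e \<longlonglongrightarrow> 0"
  obtains k where "strict_mono (k :: nat \<Rightarrow> nat)"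
    "\<And>x. x \<in> S \<Longrightarrow> \<exists>l\<in>D. (\<lambda>n. F (k n) x) \<longlonglongrightarrow> l"
proof (cases "S = {}")
  case True
  show ?thesis by (rule that[of id]) (auto simp: strict_mono_id True)
next
  case False
  obtain R where R: "countable R" "R \<subseteq> S" "S \<subseteq> closure R"
    using separable by blast
  then have "R \<noteq> {}" using False by auto
  then obtain q where q: "R = range (q :: nat \<Rightarrow> 'a)"
    using \<open>countable R\<close> uncountable_def by blast
  have qS: "q i \<in> S" for i using q R by auto
  obtain k :: "nat \<Rightarrow> nat" where k: "strict_mono k"
    "\<And>i. \<exists>l. (\<lambda>n. (F \<circ> k) n (q i)) \<longlonglongrightarrow> l"
  proof (rule subsequence_diagonalization_lemma
      [of "\<lambda>i r. \<exists>l. ((\<lambda>n. (F \<circ> r) n (q i)) \<longlonglongrightarrow> l)" id])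
    show "\<exists>k::nat\<Rightarrow>nat. strict_mono k \<and> (\<exists>l. (\<lambda>n. (F \<circ> (r \<circ> k)) n (q i)) \<longlonglongrightarrow> l)" for i r
      using compact_imp_seq_compact[OF D] FD[OF qS]
      by (force simp: o_def seq_compact_def)
    show "\<exists>l. (\<lambda>n. (F \<circ> (r \<circ> k2)) n (q i)) \<longlonglongrightarrow> l"
      if "\<exists>l. (\<lambda>n. (F \<circ> (r \<circ> k1)) n (q i)) \<longlonglongrightarrow> l" "\<And>j. N \<le> j \<Longrightarrow> \<exists>j'\<ge>j. k2 j = k1 j'"
      for i N and r k1 k2 :: "nat\<Rightarrow>nat"
      using that
      by (simp add: lim_sequentially) (metis (no_types, opaque_lifting) le_cases order_trans)
  qed auto
  show ?thesis
  proof (rule that[OF k(1)])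
    fix x assume x: "x \<in> S"
    have "Cauchy (\<lambda>n. F (k n) x)"
    proof (rule metric_CauchyI)
      fix \<epsilon> :: real assume \<epsilon>: "\<epsilon> > 0"
      \<comment> \<open>The distance of two values at \<open>x\<close> has five contributions: the Lipschitz term and the
        oscillation, twice each, for passing to \<open>q i\<close>, and the distance of the values at \<open>q i\<close>.\<close>
      define \<eta> where "\<eta> = \<epsilon> / (5 * (\<bar>L\<bar> + 1))"
      have \<eta>: "\<eta> > 0" "\<bar>L\<bar> * \<eta> < \<epsilon> / 5"
        using \<epsilon> by (auto simp: \<eta>_def field_simps add_pos_nonneg)
      obtain i where i: "dist (q i) x < \<eta>"
        using x R(3) \<eta>(1) closure_approachable[of x "range q"] unfolding q by blast
      have "L * dist (q i) x \<le> \<bar>L\<bar> * \<eta>"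
        using i by (intro mult_mono) auto
      with \<eta> have Li: "L * dist (q i) x < \<epsilon> / 5" by simp
      have "Cauchy (\<lambda>n. F (k n) (q i))"
        using k(2)[of i] LIMSEQ_imp_Cauchy by auto
      then obtain M1 where M1: "\<And>m n. m \<ge> M1 \<Longrightarrow> n \<ge> M1 \<Longrightarrow> dist (F (k m) (q i)) (F (k n) (q i)) < \<epsilon> / 5"
        using metric_CauchyD[of _ "\<epsilon> / 5"] \<epsilon> by fastforce
      have "(\<lambda>n. e (k n)) \<longlonglongrightarrow> 0"
        using LIMSEQ_subseq_LIMSEQ[OF e k(1)] by (simp add: o_def)
      then have "\<forall>\<^sub>F n in sequentially. e (k n) < \<epsilon> / 5"
        by (rule order_tendstoD) (use \<epsilon> in simp)
      then obtain M2 where M2: "\<And>n. n \<ge> M2 \<Longrightarrow> e (k n) < \<epsilon> / 5"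
        by (auto simp: eventually_sequentially)
      show "\<exists>M. \<forall>m\<ge>M. \<forall>n\<ge>M. dist (F (k m) x) (F (k n) x) < \<epsilon>"
      proof (intro exI[of _ "max M1 M2"] allI impI)
        fix m n assume mn: "max M1 M2 \<le> m" "max M1 M2 \<le> n"
        have "dist (F (k m) x) (F (k n) x) \<le> dist (F (k m) (q i)) (F (k m) x)
            + dist (F (k m) (q i)) (F (k n) (q i)) + dist (F (k n) (q i)) (F (k n) x)"
          by (smt (verit) dist_commute dist_triangle)
        with lip[OF qS x, of "k m" i] lip[OF qS x, of "k n" i] Li M1[of m n] M2[of m] M2[of n] mn
        show "dist (F (k m) x) (F (k n) x) < \<epsilon>" by auto
      qed
    qed
    then show "\<exists>l\<in>D. (\<lambda>n. F (k n) x) \<longlonglongrightarrow> l"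
      using compact_imp_complete[OF D] FD[OF x] by (auto simp: complete_def)
  qed
qed

section \<open>Differential equations in convex sets\<close>

text \<open>Tangency alone provides, at each point, approximate directions with an admissible step size that
  depends on the point. What makes the step size uniform is that the target \<open>y\<close> and the factor \<open>s\<close>
  may be left unchanged on a neighbourhood, so that a finite subcover bounds all the factors in use.\<close>
lemma uniform_feasible_direction:
  fixes f p :: "'z::metric_space \<Rightarrow> 'a::real_normed_vector"
  assumes K: "convex K" and P: "compact P"
    and f: "continuous_on P f" and p: "continuous_on P p" "\<And>z. z \<in> P \<Longrightarrow> p z \<in> K"
    and tangent: "\<And>z. z \<in> P \<Longrightarrow> f z \<in> closure {s *\<^sub>R (y - p z) | s y. s \<ge> 0 \<and> y \<in> K}"
    and c: "\<And>z. z \<in> P \<Longrightarrow> norm (f z) \<le> c" "c > 0" and "\<epsilon> > 0"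
  obtains \<delta> where "\<delta> > 0"
    "\<And>z. z \<in> P \<Longrightarrow> \<exists>v. norm v \<le> c \<and> norm (v - f z) \<le> \<epsilon> \<and> (\<forall>h\<in>{0..\<delta>}. p z + h *\<^sub>R v \<in> K)"
proof -
  define \<eta> where "\<eta> = \<epsilon> / 2"
  have \<eta>: "\<eta> > 0" using \<open>\<epsilon> > 0\<close> by (simp add: \<eta>_def)
  have "\<exists>s y. s \<ge> 0 \<and> y \<in> K \<and> norm (s *\<^sub>R (y - p z) - f z) < \<eta>" if "z \<in> P" for z
    using tangent[OF that] \<eta> unfolding closure_approachable dist_norm by blast
  then obtain s y where sy: "\<And>z. z \<in> P \<Longrightarrow> s z \<ge> 0" "\<And>z. z \<in> P \<Longrightarrow> y z \<in> K"
    "\<And>z. z \<in> P \<Longrightarrow> norm (s z *\<^sub>R (y z - p z) - f z) < \<eta>"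
    by metis
  have "\<exists>d>0. \<forall>z'\<in>P. dist z' z < d \<longrightarrow> norm (s z *\<^sub>R (y z - p z') - f z') < \<eta>" if z: "z \<in> P" for z
  proof -
    have "continuous_on P (\<lambda>z'. norm (s z *\<^sub>R (y z - p z') - f z'))"
      by (intro continuous_intros f p)
    then obtain d where "d > 0" "\<And>z'. z' \<in> P \<Longrightarrow> dist z' z < d \<Longrightarrow>
        dist (norm (s z *\<^sub>R (y z - p z') - f z')) (norm (s z *\<^sub>R (y z - p z) - f z))
          < \<eta> - norm (s z *\<^sub>R (y z - p z) - f z)"
      unfolding continuous_on_iff using z sy(3)[OF z] by (meson diff_gt_0_iff_gt)
    then show ?thesis
      by (intro exI[of _ d]) (force simp: dist_real_def)
  qed
  then obtain d where d: "\<And>z. z \<in> P \<Longrightarrow> d z > 0" "\<And>z z'. z \<in> P \<Longrightarrow> z' \<in> P \<Longrightarrow> dist z' z < d z \<Longrightarrow>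
      norm (s z *\<^sub>R (y z - p z') - f z') < \<eta>"
    by metis
  obtain C where C: "C \<subseteq> P" "finite C" "P \<subseteq> (\<Union>z\<in>C. ball z (d z))"
  proof (rule compactE_image[OF P, of P "\<lambda>z. ball z (d z)"])
    show "P \<subseteq> (\<Union>z\<in>P. ball z (d z))" using d(1) by force
  qed auto
  define L where "L = 1 + sum s C"
  have s_nonneg: "s z \<ge> 0" if "z \<in> C" for z
    using that C(1) sy(1) by blast
  have "s z \<le> sum s C" if "z \<in> C" for z
    using that C(2) s_nonneg by (intro member_le_sum) auto
  moreover have "sum s C \<ge> 0"
    by (intro sum_nonneg s_nonneg)
  ultimately have L: "L > 0" "\<And>z. z \<in> C \<Longrightarrow> s z \<le> L"
    by (simp_all add: L_def add_increasing)
  show ?thesis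
  proof (rule that[of "1 / L"])
    show "1 / L > 0" using L by simp
    fix z assume z: "z \<in> P"
    then obtain x where x: "x \<in> C" "dist z x < d x"
      using C(3) by (auto simp: dist_commute)
    define w where "w = s x *\<^sub>R (y x - p z)"
    \<comment> \<open>The direction \<open>w\<close> may be longer than \<open>c\<close> by \<open>\<eta>\<close>; the factor \<open>q\<close> removes the excess.
      Shortening a direction keeps it feasible.\<close>
    define q where "q = c / (c + \<eta>)"
    have q: "0 \<le> q" "q \<le> 1" "(c + \<eta>) * q = c" "(c + \<eta>) * (1 - q) = \<eta>"
      using c \<eta> by (auto simp: q_def field_simps)
    have wf: "norm (w - f z) < \<eta>"
      unfolding w_def using d(2)[of x z] x z C(1) by auto
    then have w: "norm w \<le> c + \<eta>"
      using c(1)[OF z] norm_triangle_sub[of w "f z"] by simp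
    show "\<exists>v. norm v \<le> c \<and> norm (v - f z) \<le> \<epsilon> \<and> (\<forall>h\<in>{0..1 / L}. p z + h *\<^sub>R v \<in> K)"
    proof (intro exI[of _ "q *\<^sub>R w"] conjI ballI)
      show "norm (q *\<^sub>R w) \<le> c"
        using mult_right_mono[OF w q(1)] q by (simp add: mult.commute)
      have "norm (q *\<^sub>R w - w) = norm w * (1 - q)"
        using q by (simp add: norm_minus_commute[of _ w] mult.commute
            flip: scaleR_left_diff_distrib[of 1, simplified])
      also have "\<dots> \<le> \<eta>"
        using mult_right_mono[OF w, of "1 - q"] q by simp
      finally show "norm (q *\<^sub>R w - f z) \<le> \<epsilon>"
        using wf norm_triangle_ineq[of "q *\<^sub>R w - w" "w - f z"] by (simp add: \<eta>_def)
      fix h assume h: "h \<in> {0..1 / L}"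
      define \<theta> where "\<theta> = h * q * s x"
      have x': "x \<in> P" using x C by auto
      have "h * q * s x \<le> (1 / L) * 1 * L"
        using h q L(2)[OF x(1)] sy(1)[OF x'] L(1) by (intro mult_mono) auto
      then have \<theta>: "0 \<le> \<theta>" "\<theta> \<le> 1"
        using h q sy(1)[OF x'] L by (auto simp: \<theta>_def)
      have "p z + h *\<^sub>R q *\<^sub>R w = (1 - \<theta>) *\<^sub>R p z + \<theta> *\<^sub>R y x"
        by (simp add: w_def \<theta>_def algebra_simps)
      also have "\<dots> \<in> K"
        using convexD_alt[OF K p(2)[OF z] sy(2)[OF x'] \<theta>] .
      finally show "p z + h *\<^sub>R q *\<^sub>R w \<in> K" .
    qed
  qed
qed

text \<open>The last assumption is the subtangent condition: the closure is the tangent cone of the convex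
  set \<open>K\<close> at \<open>x\<close>.\<close>
locale tangent_field =
  fixes K :: "'a::real_normed_vector set" and x\<^sub>0 :: 'a and f :: "real \<Rightarrow> 'a \<Rightarrow> 'a"
    and T r c :: real
  assumes convex: "convex K" and start: "x\<^sub>0 \<in> K"
    and compact: "compact (K \<inter> cball x\<^sub>0 r)"
    and pos: "T > 0" "r > 0" "c > 0"
    and continuous: "continuous_on ({0..T} \<times> (K \<inter> cball x\<^sub>0 r)) (\<lambda>(t, x). f t x)"
    and bound: "\<And>t x. t \<in> {0..T} \<Longrightarrow> x \<in> K \<inter> cball x\<^sub>0 r \<Longrightarrow> norm (f t x) \<le> c"
    and tangent: "\<And>t x. t \<in> {0..T} \<Longrightarrow> x \<in> K \<inter> cball x\<^sub>0 r \<Longrightarrow>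
      f t x \<in> closure {s *\<^sub>R (y - x) | s y. s \<ge> 0 \<and> y \<in> K}"
begin

abbreviation D :: "'a set" where "D \<equiv> K \<inter> cball x\<^sub>0 r"
abbreviation b :: real where "b \<equiv> min T (r / c)"

lemma b_pos: "b > 0"
  using pos by simp

text \<open>The approximate solution is the step function with values \<open>X k\<close> on \<open>{k * h..<(k + 1) * h}\<close> for
  the nodes \<open>X k\<close> of Euler's scheme. The last property replaces the approximate differential
  equation: the increment over \<open>{s..t}\<close> is a sum of Euler steps \<open>h *\<^sub>R V i\<close> with \<open>V i\<close> within \<open>\<eta> + \<epsilon>\<close> of \<open>w\<close>. The
  first of these steps may start up to \<open>h \<le> \<epsilon>\<close> before \<open>s\<close>, which is why the field is compared with \<open>w\<close>
  from time \<open>s - \<epsilon>\<close> on and why the length \<open>t - s\<close> is matched only up to \<open>\<epsilon>\<close>.\<close>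
lemma approximate_solution:
  assumes \<epsilon>: "\<epsilon> > 0"
  obtains x where "x 0 = x\<^sub>0" "\<And>t. t \<in> {0..b} \<Longrightarrow> x t \<in> D"
    "\<And>s t. 0 \<le> s \<Longrightarrow> s \<le> t \<Longrightarrow> t \<le> b \<Longrightarrow> norm (x t - x s) \<le> c * (t - s) + \<epsilon>"
    "\<And>s t w \<eta>. 0 \<le> s \<Longrightarrow> s \<le> t \<Longrightarrow> t \<le> b \<Longrightarrow> 
      (\<And>u. u \<in> {0..t} \<Longrightarrow> s - \<epsilon> \<le> u \<Longrightarrow> norm (f u (x u) - w) \<le> \<eta>) \<Longrightarrow> \<eta> \<ge> 0 \<Longrightarrow>
      norm (x t - x s - (t - s) *\<^sub>R w) \<le> (\<eta> + \<epsilon>) * (t - s + \<epsilon>) + \<epsilon> * norm w"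
proof -
  obtain \<delta> where \<delta>: "\<delta> > 0" "\<And>z. z \<in> {0..T} \<times> D \<Longrightarrow>
      \<exists>v. norm v \<le> c \<and> norm (v - (case z of (t, x) \<Rightarrow> f t x)) \<le> \<epsilon> \<and> (\<forall>h\<in>{0..\<delta>}. snd z + h *\<^sub>R v \<in> K)"
  proof (rule uniform_feasible_direction[of K "{0..T} \<times> D" "\<lambda>(t, x). f t x" snd c \<epsilon>])
    show "compact ({0..T} \<times> D)" by (intro compact_Times compact) simp
  qed (use convex continuous bound tangent pos \<epsilon> in \<open>auto intro: continuous_on_snd continuous_on_id\<close>)
  then have "\<exists>v. norm v \<le> c \<and> norm (v - f t x) \<le> \<epsilon> \<and> (\<forall>h\<in>{0..\<delta>}. x + h *\<^sub>R v \<in> K)"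
    if "t \<in> {0..T}" "x \<in> D" for t x
    using that by fastforce
  then obtain v where v: "\<And>t x. t \<in> {0..T} \<Longrightarrow> x \<in> D \<Longrightarrow> norm (v t x) \<le> c"
    "\<And>t x. t \<in> {0..T} \<Longrightarrow> x \<in> D \<Longrightarrow> norm (v t x - f t x) \<le> \<epsilon>"
    "\<And>t x h. t \<in> {0..T} \<Longrightarrow> x \<in> D \<Longrightarrow> h \<in> {0..\<delta>} \<Longrightarrow> x + h *\<^sub>R v t x \<in> K"
    by metis
  define h where "h = min \<delta> (min \<epsilon> (\<epsilon> / c))"
  have h: "h > 0" "h \<le> \<delta>" "h \<le> \<epsilon>" "h \<le> \<epsilon> / c"
    using \<delta>(1) \<epsilon> pos by (simp_all add: h_def)
  then have ch: "c * h \<le> \<epsilon>"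
    using pos by (simp add: field_simps)
  define X where "X = rec_nat x\<^sub>0 (\<lambda>k x. x + h *\<^sub>R v (k * h) x)"
  define V where "V k = v (k * h) (X k)" for k :: nat
  have X0: "X 0 = x\<^sub>0" and XSuc: "X (Suc k) = X k + h *\<^sub>R V k" for k
    by (simp_all add: X_def V_def)
  have reach: "k * h * c \<le> r" if "k * h \<le> b" for k :: nat
    using that pos by (simp add: pos_le_divide_eq)
  have time: "k * h \<in> {0..T}" if "k * h \<le> b" for k :: nat
    using that h by simp
  \<comment> \<open>One induction for both claims: the distance to the start guarantees that the field is available
    at the next node, the speed limit \<open>c\<close> in turn bounds the distance.\<close>
  have K: "X k \<in> K \<and> norm (X k - x\<^sub>0) \<le> k * h * c" if "k * h \<le> b" for k
    using that
  proof (induction k)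
    case 0
    then show ?case using start by (simp add: X0)
  next
    case (Suc k)
    have k: "k * h \<le> b"
      using Suc.prems h(1) by (simp add: algebra_simps)
    have XD: "X k \<in> D"
      using Suc.IH[OF k] reach[OF k] by (simp add: dist_norm norm_minus_commute)
    have "norm (X (Suc k) - x\<^sub>0) \<le> norm (X k - x\<^sub>0) + norm (h *\<^sub>R V k)"
      unfolding XSuc using norm_triangle_ineq[of "X k - x\<^sub>0" "h *\<^sub>R V k"] by (simp add: algebra_simps)
    also have "\<dots> \<le> k * h * c + h * c"
      using Suc.IH[OF k] v(1)[OF time[OF k] XD] h(1) by (intro add_mono) (auto simp: V_def)
    finally have "norm (X (Suc k) - x\<^sub>0) \<le> Suc k * h * c"
      by (simp add: algebra_simps)
    moreover have "X (Suc k) \<in> K"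
      using v(3)[OF time[OF k] XD, of h] h by (simp add: XSuc V_def)
    ultimately show ?case by simp
  qed
  have D: "X k \<in> D" if "k * h \<le> b" for k
    using K[OF that] reach[OF that] by (simp add: dist_norm norm_minus_commute)
  have Vc: "norm (V k) \<le> c" and Vf: "norm (V k - f (k * h) (X k)) \<le> \<epsilon>" if "k * h \<le> b" for k
    using v(1,2)[OF time[OF that] D[OF that]] by (auto simp: V_def)
  have telescope: "norm (X m - X k - (real (m - k) * h) *\<^sub>R w) \<le> real (m - k) * h * e"
    if "k \<le> m" "\<And>i. k \<le> i \<Longrightarrow> i < m \<Longrightarrow> norm (V i - w) \<le> e" for k m w e
    using that
  proof (induction m rule: dec_induct)
    case base
    then show ?case by simp
  next
    case (step m)
    have "X (Suc m) - X k - (real (Suc m - k) * h) *\<^sub>R w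
        = (X m - X k - (real (m - k) * h) *\<^sub>R w) + h *\<^sub>R (V m - w)"
      using step.hyps by (simp add: XSuc of_nat_diff algebra_simps)
    also have "norm \<dots> \<le> real (m - k) * h * e + h * e"
      using step h(1) by (intro norm_triangle_mono) auto
    finally show ?case
      using step.hyps by (simp add: of_nat_diff algebra_simps)
  qed
  define N where "N t = nat \<lfloor>t / h\<rfloor>" for t
  have N: "N t * h \<le> t" "t < N t * h + h" if "t \<ge> 0" for t
  proof -
    have "real (N t) = \<lfloor>t / h\<rfloor>" using that h(1) by (simp add: N_def)
    then have "N t \<le> t / h" "t / h < N t + 1" by linarith+
    then show "N t * h \<le> t" "t < N t * h + h" using h(1) by (simp_all add: field_simps)
  qed
  have N_mono: "N s \<le> N t" if "s \<le> t" for s t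
    unfolding N_def using that h(1) by (intro nat_mono floor_mono) (simp add: divide_right_mono)
  have N_node: "N (i * h) = i" for i :: nat
    using h(1) by (simp add: N_def)
  have N0: "N 0 = 0" by (simp add: N_def)
  have len: "real (N t - N s) * h \<le> t - s + h" "\<bar>real (N t - N s) * h - (t - s)\<bar> \<le> h" if "0 \<le> s" "s \<le> t" for s t
    using N[of s] N[of t] N_mono[OF that(2)] that by (auto simp: of_nat_diff algebra_simps abs_le_iff)
  show ?thesis
  proof (rule that[of "\<lambda>t. X (N t)"])
    show "X (N 0) = x\<^sub>0" by (simp add: N0 X0)
    show "X (N t) \<in> D" if "t \<in> {0..b}" for t
      using D[of "N t"] N[of t] that by simp
    show "norm (X (N t) - X (N s)) \<le> c * (t - s) + \<epsilon>" if st: "0 \<le> s" "s \<le> t" "t \<le> b" for s t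
    proof -
      have "norm (X (N t) - X (N s) - (real (N t - N s) * h) *\<^sub>R 0) \<le> real (N t - N s) * h * c"
      proof (rule telescope[OF N_mono[OF st(2)]])
        fix i assume "i < N t"
        then have "i * h \<le> N t * h" using h(1) by simp
        then show "norm (V i - 0) \<le> c"
          using Vc[of i] N(1)[of t] st by simp
      qed
      also have "\<dots> \<le> (t - s + h) * c"
        using len(1)[OF st(1,2)] pos by (intro mult_right_mono) auto
      also have "\<dots> \<le> c * (t - s) + \<epsilon>"
        using ch by (simp add: algebra_simps)
      finally show ?thesis by simp
    qed
    show "norm (X (N t) - X (N s) - (t - s) *\<^sub>R w) \<le> (\<eta> + \<epsilon>) * (t - s + \<epsilon>) + \<epsilon> * norm w"
      if st: "0 \<le> s" "s \<le> t" "t \<le> b" and \<eta>: "\<eta> \<ge> 0"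
        and w: "\<And>u. u \<in> {0..t} \<Longrightarrow> s - \<epsilon> \<le> u \<Longrightarrow> norm (f u (X (N u)) - w) \<le> \<eta>" for s t w \<eta>
    proof -
      define l where "l = real (N t - N s) * h"
      have "norm (X (N t) - X (N s) - l *\<^sub>R w) \<le> l * (\<eta> + \<epsilon>)"
        unfolding l_def
      proof (rule telescope[OF N_mono[OF st(2)]])
        fix i assume i: "N s \<le> i" "i < N t"
        then have "i * h \<le> N t * h" "N s * h \<le> i * h" using h(1) by simp_all
        then have ih: "0 \<le> i * h" "i * h \<le> t" "s - \<epsilon> \<le> i * h"
          using N(1)[of t] N(2)[of s] h(1,3) st by (simp, linarith+)
        have "norm (f (i * h) (X i) - w) \<le> \<eta>"
          using w[of "i * h"] ih by (simp add: N_node)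
        moreover have "norm (V i - f (i * h) (X i)) \<le> \<epsilon>"
          using Vf[of i] ih st by simp
        ultimately show "norm (V i - w) \<le> \<eta> + \<epsilon>"
          using norm_triangle_ineq[of "V i - f (i * h) (X i)" "f (i * h) (X i) - w"] by simp
      qed
      also have "\<dots> \<le> (t - s + \<epsilon>) * (\<eta> + \<epsilon>)"
        using len(1)[OF st(1,2)] \<eta> \<epsilon> h(3) by (intro mult_right_mono) (auto simp: l_def)
      finally have 1: "norm (X (N t) - X (N s) - l *\<^sub>R w) \<le> (\<eta> + \<epsilon>) * (t - s + \<epsilon>)"
        by (simp add: mult.commute)
      have 2: "norm ((l - (t - s)) *\<^sub>R w) \<le> \<epsilon> * norm w"
        using len(2)[OF st(1,2)] h(3) by (auto simp: l_def intro!: mult_right_mono)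
      have split: "X (N t) - X (N s) - (t - s) *\<^sub>R w = (X (N t) - X (N s) - l *\<^sub>R w) + (l - (t - s)) *\<^sub>R w"
        by (simp add: algebra_simps)
      show ?thesis
        by (subst split) (rule norm_triangle_mono[OF 1 2])
    qed
  qed
qed

text \<open>A limit of the approximate solutions solves the equation: by continuity of \<open>f\<close> at the single point
  \<open>(t, x t)\<close>, the field along the approximations stays near \<open>w = f t (x t)\<close> for times near \<open>t\<close>, because
  the approximations converge at \<open>t\<close> and are almost Lipschitz. Hence pointwise convergence is enough.\<close>
theorem solution_exists:
  obtains x where "continuous_on {0..b} x" "\<And>t. t \<in> {0..b} \<Longrightarrow> x t \<in> D" "x 0 = x\<^sub>0"
    "\<And>t. t \<in> {0<..<b} \<Longrightarrow> (x has_vector_derivative f t (x t)) (at t)"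
proof -
  define e where "e n = inverse (real (Suc n))" for n
  have e: "e n > 0" for n by (simp add: e_def)
  have e_lim: "e \<longlonglongrightarrow> 0"
    unfolding e_def by (rule LIMSEQ_inverse_real_of_nat)
  have "\<exists>x. x 0 = x\<^sub>0 \<and> (\<forall>t. t \<in> {0..b} \<longrightarrow> x t \<in> D) \<and>
    (\<forall>s t. 0 \<le> s \<longrightarrow> s \<le> t \<longrightarrow> t \<le> b \<longrightarrow> norm (x t - x s) \<le> c * (t - s) + e n) \<and>
    (\<forall>s t w \<eta>. 0 \<le> s \<longrightarrow> s \<le> t \<longrightarrow> t \<le> b \<longrightarrow> 
      (\<forall>u. u \<in> {0..t} \<longrightarrow> s - e n \<le> u \<longrightarrow> norm (f u (x u) - w) \<le> \<eta>) \<longrightarrow> \<eta> \<ge> 0 \<longrightarrow>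
      norm (x t - x s - (t - s) *\<^sub>R w) \<le> (\<eta> + e n) * (t - s + e n) + e n * norm w)" for n
    by (rule approximate_solution[OF e[of n]]) blast
  then obtain F where F0: "\<And>n. F n 0 = x\<^sub>0" and FD: "\<And>n t. t \<in> {0..b} \<Longrightarrow> F n t \<in> D"
    and Flip: "\<And>n s t. 0 \<le> s \<Longrightarrow> s \<le> t \<Longrightarrow> t \<le> b \<Longrightarrow> norm (F n t - F n s) \<le> c * (t - s) + e n"
    and Fder: "\<And>n s t w \<eta>. 0 \<le> s \<Longrightarrow> s \<le> t \<Longrightarrow> t \<le> b \<Longrightarrow> 
      (\<And>u. u \<in> {0..t} \<Longrightarrow> s - e n \<le> u \<Longrightarrow> norm (f u (F n u) - w) \<le> \<eta>) \<Longrightarrow> \<eta> \<ge> 0 \<Longrightarrow>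
      norm (F n t - F n s - (t - s) *\<^sub>R w) \<le> (\<eta> + e n) * (t - s + e n) + e n * norm w"
    by metis
  have Fdist: "dist (F n s) (F n t) \<le> c * dist s t + e n" if "s \<in> {0..b}" "t \<in> {0..b}" for n s t
    using Flip[of s t n] Flip[of t s n] that
    by (cases "s \<le> t") (auto simp: dist_norm norm_minus_commute)
  obtain k where k: "strict_mono (k :: nat \<Rightarrow> nat)"
    "\<And>t. t \<in> {0..b} \<Longrightarrow> \<exists>l\<in>D. (\<lambda>n. F (k n) t) \<longlonglongrightarrow> l"
    by (rule pointwise_convergent_subsequence[OF compact, of "{0..b}" F c e])
      (use FD Fdist e_lim in auto)
  then obtain x where xD: "\<And>t. t \<in> {0..b} \<Longrightarrow> x t \<in> D"
    and lim: "\<And>t. t \<in> {0..b} \<Longrightarrow> (\<lambda>n. F (k n) t) \<longlonglongrightarrow> x t"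
    by metis
  have ek: "(\<lambda>n. e (k n)) \<longlonglongrightarrow> 0"
    using LIMSEQ_subseq_LIMSEQ[OF e_lim k(1)] by (simp add: o_def)
  have xlip: "dist (x s) (x t) \<le> c * dist s t" if "s \<in> {0..b}" "t \<in> {0..b}" for s t
  proof (rule LIMSEQ_le)
    show "(\<lambda>n. dist (F (k n) s) (F (k n) t)) \<longlonglongrightarrow> dist (x s) (x t)"
      by (intro tendsto_dist lim that)
    show "(\<lambda>n. c * dist s t + e (k n)) \<longlonglongrightarrow> c * dist s t"
      using tendsto_add[OF tendsto_const ek] by simp
  qed (use Fdist that in blast)
  show ?thesis
  proof (rule that[of x])
    have "c-lipschitz_on {0..b} x"
      by (rule lipschitz_onI) (use xlip pos in auto)
    then show "continuous_on {0..b} x" by (rule lipschitz_on_continuous_on)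
    show "x t \<in> D" if "t \<in> {0..b}" for t by (fact xD[OF that])
    have "(\<lambda>n. F (k n) 0) \<longlonglongrightarrow> x 0" by (rule lim) (use b_pos in simp)
    then show "x 0 = x\<^sub>0" unfolding F0 by (simp add: LIMSEQ_const_iff)
    fix t assume t: "t \<in> {0<..<b}"
    then have t': "t \<in> {0..b}" and tT: "t \<in> {0..T}" by auto
    define w where "w = f t (x t)"
    have near: "\<exists>\<delta>>0. \<forall>s s'. t - \<delta> < s \<longrightarrow> s \<le> s' \<longrightarrow> s' < t + \<delta> \<longrightarrow>
        norm (x s' - x s - (s' - s) *\<^sub>R w) \<le> \<eta> * (s' - s)" if \<eta>: "\<eta> > 0" for \<eta>
    proof -
      have "(t, x t) \<in> {0..T} \<times> D" using tT xD[OF t'] by simp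
      then obtain d where d: "d > 0" "\<And>u y. u \<in> {0..T} \<Longrightarrow> y \<in> D \<Longrightarrow> dist (u, y) (t, x t) < d \<Longrightarrow>
          norm (f u y - w) < \<eta>"
        using continuous \<eta> unfolding continuous_on_iff w_def dist_norm by fastforce
      \<comment> \<open>Times within \<open>2 * \<delta>\<close> of \<open>t\<close> contribute at most \<open>2 * (c + 1) * \<delta> \<le> d / 2\<close> to the distance
        from \<open>(t, x t)\<close>; the oscillation \<open>e (k n)\<close> and the error at \<open>t\<close> get \<open>d / 4\<close> each.\<close>
      define \<delta> where "\<delta> = min (d / (4 * (c + 1))) (min t (b - t))"
      have c1: "c + 1 > 0" using pos by simp
      have "\<delta> > 0" using d(1) c1 t by (simp add: \<delta>_def)
      moreover have "\<delta> \<le> t" "\<delta> \<le> b - t" by (simp_all add: \<delta>_def)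
      moreover have "\<delta> \<le> d / (4 * (c + 1))" by (simp add: \<delta>_def)
      then have "(c + 1) * \<delta> \<le> d / 4" using c1 by (simp add: field_simps)
      ultimately have \<delta>: "\<delta> > 0" "\<delta> \<le> t" "\<delta> \<le> b - t" "(c + 1) * \<delta> \<le> d / 4" by blast+
      show ?thesis
      proof (intro exI[of _ \<delta>] conjI allI impI)
        fix s s' assume s: "t - \<delta> < s" "s \<le> s'" "s' < t + \<delta>"
        have sb: "s \<in> {0..b}" "s' \<in> {0..b}" using s \<delta> by auto
        have "\<forall>\<^sub>F n in sequentially. e (k n) < min \<delta> (d / 4)"
          by (rule order_tendstoD(2)[OF ek]) (use \<delta> d in simp)
        moreover have "\<forall>\<^sub>F n in sequentially. dist (F (k n) t) (x t) < d / 4"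
          by (rule tendstoD[OF lim[OF t']]) (use d in simp)
        ultimately have "\<forall>\<^sub>F n in sequentially. norm (F (k n) s' - F (k n) s - (s' - s) *\<^sub>R w)
            \<le> (\<eta> + e (k n)) * (s' - s + e (k n)) + e (k n) * norm w"
        proof eventually_elim
          case (elim n)
          show ?case
          proof (rule Fder)
            fix u assume u: "u \<in> {0..s'}" "s - e (k n) \<le> u"
            then have ub: "u \<in> {0..b}" using sb by auto
            have ut: "dist u t < 2 * \<delta>" using u s elim(1) by (simp add: dist_real_def abs_less_iff)
            have "c * dist u t \<le> c * (2 * \<delta>)" using ut pos by (intro mult_left_mono) auto
            then have "dist (F (k n) u) (x t) \<le> c * (2 * \<delta>) + e (k n) + dist (F (k n) t) (x t)"
              using Fdist[OF ub t', of "k n"] dist_triangle[of "F (k n) u" "x t" "F (k n) t"] by simp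
            then have "dist u t + dist (F (k n) u) (x t) < d"
              using ut elim \<delta>(4) by (simp add: algebra_simps)
            moreover have "dist (u, F (k n) u) (t, x t) \<le> dist u t + dist (F (k n) u) (x t)"
              unfolding dist_Pair_Pair by (rule sqrt_sum_squares_le_sum) auto
            ultimately show "norm (f u (F (k n) u) - w) \<le> \<eta>"
              using d(2)[of u "F (k n) u"] ub FD[OF ub, of "k n"] by simp
          qed (use sb s \<eta> in auto)
        qed
        moreover have "(\<lambda>n. norm (F (k n) s' - F (k n) s - (s' - s) *\<^sub>R w))
            \<longlonglongrightarrow> norm (x s' - x s - (s' - s) *\<^sub>R w)"
          by (intro tendsto_intros lim sb)
        moreover have "(\<lambda>n. (\<eta> + e (k n)) * (s' - s + e (k n)) + e (k n) * norm w)
            \<longlonglongrightarrow> (\<eta> + 0) * (s' - s + 0) + 0 * norm w"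
          by (intro tendsto_intros ek)
        ultimately have "norm (x s' - x s - (s' - s) *\<^sub>R w) \<le> (\<eta> + 0) * (s' - s + 0) + 0 * norm w"
          by (intro tendsto_le[OF sequentially_bot])
        then show "norm (x s' - x s - (s' - s) *\<^sub>R w) \<le> \<eta> * (s' - s)" by simp
      qed (fact \<delta>(1))
    qed
    have "(x has_derivative (\<lambda>h. h *\<^sub>R w)) (at t)"
      unfolding has_derivative_at_alt
    proof (intro conjI allI impI bounded_linear_scaleR_left)
      fix \<eta> :: real assume "\<eta> > 0"
      then obtain \<delta> where \<delta>: "\<delta> > 0" "\<And>s s'. t - \<delta> < s \<Longrightarrow> s \<le> s' \<Longrightarrow> s' < t + \<delta> \<Longrightarrow>
          norm (x s' - x s - (s' - s) *\<^sub>R w) \<le> \<eta> * (s' - s)"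
        using near by meson
      show "\<exists>d>0. \<forall>y. norm (y - t) < d \<longrightarrow>
          norm (x y - x t - (y - t) *\<^sub>R w) \<le> \<eta> * norm (y - t)"
      proof (intro exI[of _ \<delta>] conjI allI impI)
        fix y assume y: "norm (y - t) < \<delta>"
        show "norm (x y - x t - (y - t) *\<^sub>R w) \<le> \<eta> * norm (y - t)"
        proof (cases "t \<le> y")
          case True
          then show ?thesis using \<delta>(2)[of t y] y \<delta>(1) by simp
        next
          case False
          have "x y - x t - (y - t) *\<^sub>R w = - (x t - x y - (t - y) *\<^sub>R w)"
            by (simp add: algebra_simps)
          then have "norm (x y - x t - (y - t) *\<^sub>R w) = norm (x t - x y - (t - y) *\<^sub>R w)"
            by (metis norm_minus_cancel)
          then show ?thesis using \<delta>(2)[of y t] y False \<delta>(1) by simp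
        qed
      qed (fact \<delta>(1))
    qed
    then show "(x has_vector_derivative f t (x t)) (at t)"
      by (simp add: has_vector_derivative_def w_def)
  qed
qed

end

section \<open>The cone of support functions\<close>

text \<open>Take for \<open>q\<close> the direction of \<open>a\<close> itself.\<close>
lemma norm_le_norm_support:
  assumes "\<And>q. vec_of_usphere q \<bullet> a \<le> apply_bcontfun g q"
  shows "norm a \<le> norm g"
proof (cases "a = 0")
  case False
  define q where "q = usphere_of_vec (a /\<^sub>R norm a)"
  have "vec_of_usphere q = a /\<^sub>R norm a"
    using False by (simp add: q_def usphere_of_vec_inverse)
  then have "vec_of_usphere q \<bullet> a = norm a"
    using False by (simp add: dot_square_norm power2_eq_square)
  then show ?thesis
    using assms[of q] norm_bounded[of g q] by simp
qed simp

text \<open>This removes convex bodies and suprema from all later arguments: a body for \<open>g\<close>, if there is one,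
  can be recovered as the intersection \<open>A\<close> of the half-spaces \<open>{a. q \<bullet> a \<le> g q}\<close>, so the only
  question is whether \<open>A\<close> touches the boundary of each of them.\<close>
lemma support_functions_iff:
  "g \<in> support_functions \<longleftrightarrow>
    (\<forall>p. \<exists>a. vec_of_usphere p \<bullet> a = apply_bcontfun g p \<and> (\<forall>q. vec_of_usphere q \<bullet> a \<le> apply_bcontfun g q))"
proof
  assume "g \<in> support_functions"
  then obtain A where A: "A \<in> convex_bodies" and g: "g = support_function A"
    by (auto simp: support_functions_def)
  then have A': "A \<noteq> {}" "compact A" by (auto simp: convex_bodies_def)
  have bdd: "bdd_above ((\<bullet>) (vec_of_usphere q) ` A)" for q
    by (intro bounded_imp_bdd_above compact_imp_bounded compact_continuous_image A' continuous_intros)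
  show "\<forall>p. \<exists>a. vec_of_usphere p \<bullet> a = apply_bcontfun g p \<and> (\<forall>q. vec_of_usphere q \<bullet> a \<le> apply_bcontfun g q)"
  proof
    fix p
    obtain a where a: "a \<in> A" "\<And>x. x \<in> A \<Longrightarrow> vec_of_usphere p \<bullet> x \<le> vec_of_usphere p \<bullet> a"
      using continuous_attains_sup[OF A'(2,1), of "(\<bullet>) (vec_of_usphere p)"]
        continuous_on_inner[OF continuous_on_const continuous_on_id] by blast
    have "(SUP x\<in>A. vec_of_usphere p \<bullet> x) = vec_of_usphere p \<bullet> a"
      using a by (intro cSup_eq_maximum) auto
    then show "\<exists>a. vec_of_usphere p \<bullet> a = apply_bcontfun g p \<and> (\<forall>q. vec_of_usphere q \<bullet> a \<le> apply_bcontfun g q)"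
      using cSUP_upper[OF a(1) bdd] by (auto simp: g apply_support_function[OF A])
  qed
next
  assume *: "\<forall>p. \<exists>a. vec_of_usphere p \<bullet> a = apply_bcontfun g p \<and> (\<forall>q. vec_of_usphere q \<bullet> a \<le> apply_bcontfun g q)"
  define A where "A = {a. \<forall>q. vec_of_usphere q \<bullet> a \<le> apply_bcontfun g q}"
  have A_Inter: "A = (\<Inter>q. {a. vec_of_usphere q \<bullet> a \<le> apply_bcontfun g q})"
    by (auto simp: A_def)
  have "norm a \<le> norm g" if "a \<in> A" for a
    using that norm_le_norm_support[of a g] by (simp add: A_def)
  then have "bounded A" by (auto simp: bounded_iff)
  moreover have "closed A" "convex A"
    unfolding A_Inter by (auto intro!: closed_INT convex_INT closed_halfspace_le convex_halfspace_le)
  moreover have "A \<noteq> {}" using * by (auto simp: A_def)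
  ultimately have A: "A \<in> convex_bodies"
    by (simp add: convex_bodies_def compact_eq_bounded_closed)
  have "g = support_function A"
  proof (rule bcontfun_eqI)
    fix p
    obtain a where "vec_of_usphere p \<bullet> a = apply_bcontfun g p" "a \<in> A"
      using * by (auto simp: A_def)
    then have "(SUP x\<in>A. vec_of_usphere p \<bullet> x) = apply_bcontfun g p"
      by (intro cSup_eq_maximum) (auto simp: A_def intro: rev_image_eqI)
    then show "apply_bcontfun g p = apply_bcontfun (support_function A) p"
      by (simp add: apply_support_function[OF A])
  qed
  then show "g \<in> support_functions" using A by (auto simp: support_functions_def)
qed

lemma add_support_functions:
  assumes "g \<in> support_functions" "h \<in> support_functions"
  shows "g + h \<in> support_functions"
  unfolding support_functions_iff
proof
  fix p
  obtain a b where "vec_of_usphere p \<bullet> a = apply_bcontfun g p" "\<And>q. vec_of_usphere q \<bullet> a \<le> apply_bcontfun g q"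
    "vec_of_usphere p \<bullet> b = apply_bcontfun h p" "\<And>q. vec_of_usphere q \<bullet> b \<le> apply_bcontfun h q"
    using assms unfolding support_functions_iff by metis
  then show "\<exists>a. vec_of_usphere p \<bullet> a = apply_bcontfun (g + h) p \<and> (\<forall>q. vec_of_usphere q \<bullet> a \<le> apply_bcontfun (g + h) q)"
    by (intro exI[of _ "a + b"]) (auto simp: inner_add_right intro: add_mono)
qed

lemma scaleR_support_functions:
  assumes "g \<in> support_functions" "l \<ge> 0"
  shows "l *\<^sub>R g \<in> support_functions"
  unfolding support_functions_iff
proof
  fix p
  obtain a where "vec_of_usphere p \<bullet> a = apply_bcontfun g p" "\<And>q. vec_of_usphere q \<bullet> a \<le> apply_bcontfun g q"
    using assms unfolding support_functions_iff by metis
  then show "\<exists>a. vec_of_usphere p \<bullet> a = apply_bcontfun (l *\<^sub>R g) p \<and> (\<forall>q. vec_of_usphere q \<bullet> a \<le> apply_bcontfun (l *\<^sub>R g) q)"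
    using assms(2) by (intro exI[of _ "l *\<^sub>R a"]) (auto intro: mult_left_mono)
qed

lemma convex_support_functions: "convex support_functions"
  by (auto simp: convex_def intro: add_support_functions scaleR_support_functions)

text \<open>The points that attain \<open>g n p\<close> are bounded by the norms of the \<open>g n\<close>; a limit point of them
  attains the limit in direction \<open>p\<close>.\<close>
lemma closed_support_functions: "closed (support_functions :: ('n::finite usphere \<Rightarrow>\<^sub>C real) set)"
  unfolding closed_sequential_limits
proof (intro allI impI, elim conjE)
  fix g and l :: "'n usphere \<Rightarrow>\<^sub>C real"
  assume g: "\<forall>n. g n \<in> support_functions" and lim: "g \<longlonglongrightarrow> l"
  have pt: "(\<lambda>n. apply_bcontfun (g n) q) \<longlonglongrightarrow> apply_bcontfun l q" for q
    using tendsto_uniform_limitI[OF tendsto_bcontfun_uniform_limit[OF lim]] by simp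
  obtain B where B: "\<And>n. norm (g n) \<le> B"
    using convergent_imp_bounded[OF lim] by (auto simp: bounded_iff)
  show "l \<in> support_functions"
    unfolding support_functions_iff
  proof
    fix p
    have "\<forall>n. \<exists>a. vec_of_usphere p \<bullet> a = apply_bcontfun (g n) p \<and> (\<forall>q. vec_of_usphere q \<bullet> a \<le> apply_bcontfun (g n) q)"
      using g unfolding support_functions_iff by blast
    then obtain a where a: "\<And>n. vec_of_usphere p \<bullet> a n = apply_bcontfun (g n) p"
      "\<And>n q. vec_of_usphere q \<bullet> a n \<le> apply_bcontfun (g n) q"
      by metis
    have "a n \<in> cball 0 B" for n
      using norm_le_norm_support[OF a(2), of n] B[of n] by simp
    then obtain x k where k: "strict_mono (k :: nat \<Rightarrow> nat)" and x: "(a \<circ> k) \<longlonglongrightarrow> x"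
      using compact_imp_seq_compact[OF compact_cball] unfolding seq_compact_def by metis
    have gk: "(\<lambda>n. apply_bcontfun (g (k n)) q) \<longlonglongrightarrow> apply_bcontfun l q" for q
      using LIMSEQ_subseq_LIMSEQ[OF pt k] by (simp add: o_def)
    have ak: "(\<lambda>n. vec_of_usphere q \<bullet> a (k n)) \<longlonglongrightarrow> vec_of_usphere q \<bullet> x" for q
      using tendsto_inner[OF tendsto_const x] by (simp add: o_def)
    show "\<exists>a. vec_of_usphere p \<bullet> a = apply_bcontfun l p \<and> (\<forall>q. vec_of_usphere q \<bullet> a \<le> apply_bcontfun l q)"
      using LIMSEQ_unique[OF ak[of p]] gk[of p] LIMSEQ_le[OF ak gk] a by (intro exI[of _ x]) auto
  qed
qed

lemma support_function_lipschitz: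
  assumes "g \<in> support_functions"
  shows "(norm g)-lipschitz_on UNIV (apply_bcontfun g)"
proof (rule lipschitz_onI)
  have le: "apply_bcontfun g p \<le> apply_bcontfun g q + norm g * dist p q" for p q
  proof -
    obtain a where a: "vec_of_usphere p \<bullet> a = apply_bcontfun g p" "\<And>q. vec_of_usphere q \<bullet> a \<le> apply_bcontfun g q"
      using assms unfolding support_functions_iff by metis
    have "(vec_of_usphere p - vec_of_usphere q) \<bullet> a \<le> dist p q * norm a"
      using norm_cauchy_schwarz by (simp add: dist_usphere_def dist_norm)
    also have "\<dots> \<le> dist p q * norm g"
      using norm_le_norm_support[OF a(2)] by (intro mult_left_mono) auto
    finally show ?thesis
      using a(1) a(2)[of q] by (simp add: inner_diff_left mult.commute)
  qed
  show "dist (apply_bcontfun g p) (apply_bcontfun g q) \<le> norm g * dist p q" for p q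
    using le[of p q] le[of q p] by (simp add: dist_real_def dist_commute abs_le_iff)
qed simp

text \<open>Blaschke's selection theorem, in terms of support functions: a bounded family of them is
  equi-Lipschitz, so the theorem of Arzela and Ascoli on the unit sphere yields a uniformly convergent
  subsequence.\<close>
lemma compact_bounded_support_functions:
  fixes x\<^sub>0 :: "'n::finite usphere \<Rightarrow>\<^sub>C real"
  shows "compact (support_functions \<inter> cball x\<^sub>0 r)"
proof -
  have "\<exists>l\<in>support_functions \<inter> cball x\<^sub>0 r. \<exists>k. strict_mono k \<and> (g \<circ> k) \<longlonglongrightarrow> l"
    if "\<forall>n. g n \<in> support_functions \<inter> cball x\<^sub>0 r" for g :: "nat \<Rightarrow> 'n usphere \<Rightarrow>\<^sub>C real"
  proof -
    define M where "M = norm x\<^sub>0 + \<bar>r\<bar>"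
    have M: "norm (g n) \<le> M" for n
      using that[rule_format, of n] norm_triangle_sub[of "g n" x\<^sub>0]
      by (auto simp: M_def dist_norm norm_minus_commute)
    have "M \<ge> 0" by (simp add: M_def)
    define G where "G n u = apply_bcontfun (g n) (usphere_of_vec u)" for n and u :: "real ^ 'n"
    have lip: "dist (G n u) (G n w) \<le> M * dist u w" if "u \<in> sphere 0 1" "w \<in> sphere 0 1" for n u w
    proof -
      have "dist (G n u) (G n w) \<le> norm (g n) * dist (usphere_of_vec u) (usphere_of_vec w)"
        unfolding G_def using \<open>\<forall>n. _\<close> support_function_lipschitz[of "g n"] by (auto dest: lipschitz_onD)
      also have "\<dots> \<le> M * dist (usphere_of_vec u) (usphere_of_vec w)"
        using M by (intro mult_right_mono) auto
      finally show ?thesis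
        using that by (simp add: dist_usphere_def usphere_of_vec_inverse)
    qed
    obtain l k where k: "strict_mono (k :: nat \<Rightarrow> nat)"
      and l: "\<And>e. 0 < e \<Longrightarrow> \<exists>N. \<forall>n x. n \<ge> N \<and> x \<in> sphere 0 1 \<longrightarrow> norm (G (k n) x - l x) < e"
    proof (rule Arzela_Ascoli[of "sphere 0 1" G M])
      show "norm (G n x) \<le> M" for n x
        unfolding G_def using norm_bounded[of "g n"] M[of n] order_trans by blast
      show "\<exists>d>0. \<forall>n y. y \<in> sphere 0 1 \<and> norm (x - y) < d \<longrightarrow> norm (G n x - G n y) < e"
        if "x \<in> sphere 0 1" "0 < e" for x :: "real ^ 'n" and e
      proof (intro exI[of _ "e / (M + 1)"] conjI allI impI)
        show "e / (M + 1) > 0" using that \<open>M \<ge> 0\<close> by simp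
        fix n y assume y: "y \<in> sphere 0 1 \<and> norm (x - y) < e / (M + 1)"
        then have "norm (G n x - G n y) \<le> M * norm (x - y)"
          using lip[of x y n] that by (simp add: dist_norm)
        also have "\<dots> \<le> M * (e / (M + 1))"
          using y \<open>M \<ge> 0\<close> by (intro mult_left_mono) auto
        also have "\<dots> < e" using that \<open>M \<ge> 0\<close> by (simp add: field_simps)
        finally show "norm (G n x - G n y) < e" .
      qed
    qed (use compact_sphere in auto)
    have "uniform_limit UNIV (\<lambda>n. apply_bcontfun (g (k n))) (\<lambda>p. l (vec_of_usphere p)) sequentially"
      unfolding uniform_limit_sequentially_iff
    proof (intro allI impI)
      fix e :: real assume "e > 0"
      then obtain N where "\<And>n x. n \<ge> N \<Longrightarrow> x \<in> sphere 0 1 \<Longrightarrow> norm (G (k n) x - l x) < e"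
        using l by meson
      then have "dist (apply_bcontfun (g (k n)) p) (l (vec_of_usphere p)) < e" if "n \<ge> N" for n p
        using that vec_of_usphere[of p] unfolding G_def dist_norm by (metis vec_of_usphere_inverse)
      then show "\<exists>N. \<forall>n\<ge>N. \<forall>p\<in>UNIV. dist (apply_bcontfun (g (k n)) p) (l (vec_of_usphere p)) < e"
        by blast
    qed
    then obtain l' where l': "(\<lambda>n. g (k n)) \<longlonglongrightarrow> l'"
      by (rule uniform_limit_bcontfunE) auto
    moreover have "l' \<in> support_functions \<inter> cball x\<^sub>0 r"
      by (rule closed_sequentially[OF closed_Int[OF closed_support_functions closed_cball] _ l'])
        (use that in blast)
    ultimately show ?thesis using k by (auto simp: o_def)
  qed
  then show ?thesis unfolding compact_def by blast
qed

text \<open>Since the support functions form a cone, \<open>\<tau> - l *\<^sub>R \<sigma>\<close> is a multiple of \<open>y - \<sigma>\<close> with \<open>y\<close> a support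
  function. Adding \<open>\<sigma>\<close> to \<open>\<tau>\<close> and \<open>1\<close> to \<open>l\<close> beforehand covers \<open>l = 0\<close> without a separate case.\<close>
lemma subtangent_cone_subset:
  assumes "\<sigma> \<in> support_functions"
  shows "subtangent_cone \<sigma> \<subseteq> closure {s *\<^sub>R (y - \<sigma>) | s y. s \<ge> 0 \<and> y \<in> support_functions}"
  unfolding subtangent_cone_def
proof (intro closure_mono subsetI)
  fix v assume "v \<in> {\<tau> - l *\<^sub>R \<sigma> | \<tau> l. \<tau> \<in> support_functions \<and> l \<ge> 0}"
  then obtain \<tau> l where \<tau>: "\<tau> \<in> support_functions" and l: "l \<ge> 0" and v: "v = \<tau> - l *\<^sub>R \<sigma>"
    by blast
  have "v = (l + 1) *\<^sub>R ((1 / (l + 1)) *\<^sub>R (\<tau> + \<sigma>) - \<sigma>)"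
    using l by (simp add: v algebra_simps)
  moreover have "(1 / (l + 1)) *\<^sub>R (\<tau> + \<sigma>) \<in> support_functions"
    using l by (intro scaleR_support_functions add_support_functions \<tau> assms) simp
  ultimately show "v \<in> {s *\<^sub>R (y - \<sigma>) | s y. s \<ge> 0 \<and> y \<in> support_functions}"
    using l by (intro CollectI exI[of _ "l + 1"] exI[of _ "(1 / (l + 1)) *\<^sub>R (\<tau> + \<sigma>)"]) auto
qed

lemma support_ball_eq: "support_ball A r = support_functions \<inter> cball (support_function A) r"
  by (auto simp: support_ball_def dist_norm norm_minus_commute)

section \<open>Differential equations for convex bodies\<close>

theorem theorem16:
  fixes f :: "real \<Rightarrow> ('n::finite usphere \<Rightarrow>\<^sub>C real) \<Rightarrow> ('n usphere \<Rightarrow>\<^sub>C real)"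
    and A\<^sub>0 :: "(real ^ 'n) set"
    and T r :: real
  assumes "T > 0"
    and "r > 0"
    and "A\<^sub>0 \<in> convex_bodies"
    and "\<And>t \<sigma>. t \<in> {0..T} \<Longrightarrow> \<sigma> \<in> support_functions \<Longrightarrow> f t \<sigma> \<in> support_differences"
    and "continuous_on ({0..T} \<times> support_functions) (\<lambda>(t, \<sigma>). f t \<sigma>)"
  shows "(\<exists>c>0. \<forall>t\<in>{0..T}. \<forall>\<sigma>\<in>support_ball A\<^sub>0 r. norm (f t \<sigma>) \<le> c) \<and>
    (\<forall>c>0. (\<forall>t\<in>{0..T}. \<forall>\<sigma>\<in>support_ball A\<^sub>0 r. norm (f t \<sigma>) \<le> c) \<longrightarrow>
      (\<forall>t\<in>{0..T}. \<forall>\<sigma>\<in>support_functions. f t \<sigma> \<in> subtangent_cone \<sigma>) \<longrightarrow>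
      (\<exists>\<sigma>. ivp_solution f (support_function A\<^sub>0) (min T (r / c)) \<sigma> \<and>
        (\<forall>t\<in>{0..min T (r / c)}. \<sigma> t \<in> support_ball A\<^sub>0 r)))"
proof -
  let ?D = "support_functions \<inter> cball (support_function A\<^sub>0) r"
  have cont: "continuous_on ({0..T} \<times> ?D) (\<lambda>(t, \<sigma>). f t \<sigma>)"
    by (rule continuous_on_subset[OF assms(5)]) auto
  have "compact ((\<lambda>(t, \<sigma>). f t \<sigma>) ` ({0..T} \<times> ?D))"
    by (intro compact_continuous_image cont compact_Times compact_bounded_support_functions) simp
  then have "bounded ((\<lambda>(t, \<sigma>). f t \<sigma>) ` ({0..T} \<times> ?D))"
    by (rule compact_imp_bounded)
  then have "\<exists>c>0. \<forall>t\<in>{0..T}. \<forall>\<sigma>\<in>support_ball A\<^sub>0 r. norm (f t \<sigma>) \<le> c"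
    unfolding bounded_pos support_ball_eq by fastforce
  moreover have "\<exists>\<sigma>. ivp_solution f (support_function A\<^sub>0) (min T (r / c)) \<sigma> \<and>
      (\<forall>t\<in>{0..min T (r / c)}. \<sigma> t \<in> support_ball A\<^sub>0 r)"
    if c: "c > 0" "\<forall>t\<in>{0..T}. \<forall>\<sigma>\<in>support_ball A\<^sub>0 r. norm (f t \<sigma>) \<le> c"
      and tangent: "\<forall>t\<in>{0..T}. \<forall>\<sigma>\<in>support_functions. f t \<sigma> \<in> subtangent_cone \<sigma>" for c
  proof -
    interpret tangent_field support_functions "support_function A\<^sub>0" f T r c
    proof
      show "support_function A\<^sub>0 \<in> support_functions"
        using assms(3) by (auto simp: support_functions_def)
      show "norm (f t \<sigma>) \<le> c" if "t \<in> {0..T}" "\<sigma> \<in> ?D" for t \<sigma>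
        using c(2) that unfolding support_ball_eq by blast
      show "f t \<sigma> \<in> closure {s *\<^sub>R (y - \<sigma>) | s y. s \<ge> 0 \<and> y \<in> support_functions}"
        if "t \<in> {0..T}" "\<sigma> \<in> ?D" for t \<sigma>
        using tangent that subtangent_cone_subset[of \<sigma>] by blast
    qed (fact convex_support_functions compact_bounded_support_functions assms(1,2) c(1) cont)+
    obtain \<sigma> where \<sigma>: "continuous_on {0..min T (r / c)} \<sigma>"
        "\<And>t. t \<in> {0..min T (r / c)} \<Longrightarrow> \<sigma> t \<in> ?D" "\<sigma> 0 = support_function A\<^sub>0"
        "\<And>t. t \<in> {0<..<min T (r / c)} \<Longrightarrow> (\<sigma> has_vector_derivative f t (\<sigma> t)) (at t)"
      using solution_exists by metis
    have "\<sigma> t \<in> support_functions" if "t \<in> {0..min T (r / c)}" for t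
      using \<sigma>(2)[OF that] by (rule IntD1)
    with \<sigma> show ?thesis
      unfolding ivp_solution_def support_ball_eq by blast
  qed
  ultimately show ?thesis by blast
qed

end
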